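(* If $p$ is any prime and $d=2(p+\lceil\sqrt{p}\rceil-1)$, then $DC(d,2)\geq 2p(p-1)$, where $DC(d,2)$ denotes the largest number of vertices in a Cayley graph of a dihedral group having degree $d$ and diameter $2$.
   Context: For a finite group $G$ and a subset $S\subset G$ which is inverse-closed and does not contain the identity, the Cayley graph $\mathrm{Cay}(G,S)$ is the undirected graph with vertex set $G$ and an edge between $g$ and $h$ if and only if $gh^{-1}\in S$. It is regular of degree $|S|$. The dihedral groups are the groups $\mathbb{Z}_m\rtimes C_2$ of order $2m$, where $C_2=\{\pm1\}$ acts on the cyclic group $\mathbb{Z}_m$ by inversion. $DC(d,k)$ is the largest number of vertices in a Cayley graph of a dihedral group having degree $d$ and diameter $k$. *)

theory Defs
  imports
    "HOL-Algebra.Elementary_Groups"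
    "HOL-Algebra.Sym_Groups"
    "HOL-Computational_Algebra.Primes"
    "Graph_Theory.Shortest_Path"
begin

section \<open>Dihedral groups\<close>

definition semidirect_prod ::
    "('n, 'a) monoid_scheme \<Rightarrow> ('h, 'b) monoid_scheme \<Rightarrow> ('h \<Rightarrow> 'n \<Rightarrow> 'n) \<Rightarrow> ('n \<times> 'h) monoid" where
  "semidirect_prod N H \<phi> =
     \<lparr>carrier = carrier N \<times> carrier H,
      monoid.mult = (\<lambda>(x, s) (y, t). (x \<otimes>\<^bsub>N\<^esub> \<phi> s y, s \<otimes>\<^bsub>H\<^esub> t)),
      one = (\<one>\<^bsub>N\<^esub>, \<one>\<^bsub>H\<^esub>)\<rparr>"

text \<open>
  The library group \<^const>\<open>sign_img\<close> is the multiplicative group on the integers 1 and -1.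
  For \<open>m = 0\<close> the library sets \<^const>\<open>integer_mod_group\<close> to be the infinite cyclic group, so
  finite dihedral groups are those with \<open>m > 0\<close>.
\<close>

definition dihedral_group :: "nat \<Rightarrow> (int \<times> int) monoid" where
  "dihedral_group m =
     semidirect_prod (integer_mod_group m) sign_img
       (\<lambda>s x. if s = 1 then x else inv\<^bsub>integer_mod_group m\<^esub> x)"

lemma carrier_dihedral_group:
  "carrier (dihedral_group m) = carrier (integer_mod_group m) \<times> {-1, 1}"
  by (simp add: dihedral_group_def semidirect_prod_def sign_img_def)

lemma one_dihedral_group: "\<one>\<^bsub>dihedral_group m\<^esub> = (0, 1)"
  by (simp add: dihedral_group_def semidirect_prod_def sign_img_def)

lemma mult_dihedral_group:
  assumes "y \<in> carrier (integer_mod_group m)" and "s \<in> {-1, 1}"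
  shows "(x, s) \<otimes>\<^bsub>dihedral_group m\<^esub> (y, t) = ((x + s * y) mod int m, s * t)"
  using assms
  by (auto simp: dihedral_group_def semidirect_prod_def sign_img_def mod_simps)

lemma order_dihedral_group: "m > 0 \<Longrightarrow> order (dihedral_group m) = 2 * m"
  by (simp add: order_def carrier_dihedral_group carrier_integer_mod_group card_cartesian_product)

lemma group_dihedral_group:
  assumes "m > 0"
  shows "group (dihedral_group m)"
proof (rule groupI)
  let ?Z = "carrier (integer_mod_group m)"
  have Z: "x mod int m \<in> ?Z" for x
    using assms by (simp add: carrier_integer_mod_group)
  show "\<one>\<^bsub>dihedral_group m\<^esub> \<in> carrier (dihedral_group m)"
    using assms by (simp add: one_dihedral_group carrier_dihedral_group carrier_integer_mod_group)
  fix a assume "a \<in> carrier (dihedral_group m)"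
  then obtain x s where a: "a = (x, s)" "x \<in> ?Z" "s \<in> {-1, 1}"
    by (auto simp: carrier_dihedral_group)
  have x: "x mod int m = x"
    using a assms by (simp add: carrier_integer_mod_group)
  have one: "0 \<in> ?Z"
    using assms by (simp add: carrier_integer_mod_group)
  show "\<one>\<^bsub>dihedral_group m\<^esub> \<otimes>\<^bsub>dihedral_group m\<^esub> a = a"
    using a x by (simp add: one_dihedral_group mult_dihedral_group)
  have "((- s * x) mod int m, s) \<otimes>\<^bsub>dihedral_group m\<^esub> a = \<one>\<^bsub>dihedral_group m\<^esub>"
    using a by (auto simp: one_dihedral_group mult_dihedral_group mod_simps)
  moreover have "((- s * x) mod int m, s) \<in> carrier (dihedral_group m)"
    using a Z by (auto simp: carrier_dihedral_group)
  ultimately show "\<exists>b\<in>carrier (dihedral_group m).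
      b \<otimes>\<^bsub>dihedral_group m\<^esub> a = \<one>\<^bsub>dihedral_group m\<^esub>"
    by blast
  fix b assume "b \<in> carrier (dihedral_group m)"
  then obtain y t where b: "b = (y, t)" "y \<in> ?Z" "t \<in> {-1, 1}"
    by (auto simp: carrier_dihedral_group)
  show "a \<otimes>\<^bsub>dihedral_group m\<^esub> b \<in> carrier (dihedral_group m)"
    using a b Z by (auto simp: mult_dihedral_group carrier_dihedral_group)
  fix c assume "c \<in> carrier (dihedral_group m)"
  then obtain z u where c: "c = (z, u)" "z \<in> ?Z" "u \<in> {-1, 1}"
    by (auto simp: carrier_dihedral_group)
  show "a \<otimes>\<^bsub>dihedral_group m\<^esub> b \<otimes>\<^bsub>dihedral_group m\<^esub> c =
        a \<otimes>\<^bsub>dihedral_group m\<^esub> (b \<otimes>\<^bsub>dihedral_group m\<^esub> c)"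
    using a b c Z by (auto simp: mult_dihedral_group mod_simps algebra_simps)
qed

section \<open>Cayley graphs\<close>

definition cayley_set :: "('a, 'b) monoid_scheme \<Rightarrow> 'a set \<Rightarrow> bool" where
  "cayley_set G S \<longleftrightarrow> S \<subseteq> carrier G \<and> (\<forall>s\<in>S. inv\<^bsub>G\<^esub> s \<in> S) \<and> \<one>\<^bsub>G\<^esub> \<notin> S"

text \<open>
  As usual in the graph library, an undirected graph is a symmetric digraph: an edge between
  \<open>g\<close> and \<open>h\<close> is the pair of arcs \<open>(g, h)\<close> and \<open>(h, g)\<close>. See \<open>graph_cayley_graph\<close> below.
\<close>

definition cayley_graph :: "('a, 'b) monoid_scheme \<Rightarrow> 'a set \<Rightarrow> ('a, 'a \<times> 'a) pre_digraph" where
  "cayley_graph G S =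
     \<lparr>verts = carrier G,
      arcs = {(g, h). g \<in> carrier G \<and> h \<in> carrier G \<and> g \<otimes>\<^bsub>G\<^esub> inv\<^bsub>G\<^esub> h \<in> S},
      tail = fst, head = snd\<rparr>"

lemma graph_cayley_graph:
  assumes "group G" and "finite (carrier G)" and "cayley_set G S"
  shows "graph (cayley_graph G S)"
proof -
  interpret group G by fact
  have "finite {(g, h). g \<in> carrier G \<and> h \<in> carrier G \<and> g \<otimes>\<^bsub>G\<^esub> inv\<^bsub>G\<^esub> h \<in> S}"
    by (rule finite_subset[of _ "carrier G \<times> carrier G"]) (use assms in auto)
  moreover have "h \<otimes>\<^bsub>G\<^esub> inv\<^bsub>G\<^esub> g \<in> S"
    if "g \<in> carrier G" "h \<in> carrier G" "g \<otimes>\<^bsub>G\<^esub> inv\<^bsub>G\<^esub> h \<in> S" for g h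
  proof -
    have "inv\<^bsub>G\<^esub> (g \<otimes>\<^bsub>G\<^esub> inv\<^bsub>G\<^esub> h) \<in> S"
      using that assms(3) by (simp add: cayley_set_def)
    then show ?thesis
      using that by (simp add: inv_mult_group)
  qed
  ultimately show ?thesis
    using assms
    by unfold_locales
      (auto simp: cayley_graph_def cayley_set_def arc_to_ends_def symmetric_conv)
qed

section \<open>Degree and diameter\<close>

definition regular_of_degree :: "('a, 'b) pre_digraph \<Rightarrow> nat \<Rightarrow> bool" where
  "regular_of_degree \<Gamma> d \<longleftrightarrow> (\<forall>v\<in>verts \<Gamma>. out_degree \<Gamma> v = d)"

lemma out_degree_cayley_graph:
  assumes "group G" and "cayley_set G S" and "g \<in> carrier G"
  shows "out_degree (cayley_graph G S) g = card S"
proof -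
  interpret group G by fact
  have S: "S \<subseteq> carrier G"
    using assms(2) by (simp add: cayley_set_def)
  have "out_arcs (cayley_graph G S) g = (\<lambda>s. (g, inv\<^bsub>G\<^esub> s \<otimes>\<^bsub>G\<^esub> g)) ` S"
  proof (intro equalityI subsetI)
    fix e assume "e \<in> out_arcs (cayley_graph G S) g"
    then obtain h where h: "e = (g, h)" "h \<in> carrier G" "g \<otimes>\<^bsub>G\<^esub> inv\<^bsub>G\<^esub> h \<in> S"
      by (auto simp: cayley_graph_def)
    then have "h = inv\<^bsub>G\<^esub> (g \<otimes>\<^bsub>G\<^esub> inv\<^bsub>G\<^esub> h) \<otimes>\<^bsub>G\<^esub> g"
      using assms(3) by (simp add: inv_mult_group m_assoc)
    with h show "e \<in> (\<lambda>s. (g, inv\<^bsub>G\<^esub> s \<otimes>\<^bsub>G\<^esub> g)) ` S"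
      by blast
  next
    fix e assume "e \<in> (\<lambda>s. (g, inv\<^bsub>G\<^esub> s \<otimes>\<^bsub>G\<^esub> g)) ` S"
    then obtain s where s: "s \<in> S" "e = (g, inv\<^bsub>G\<^esub> s \<otimes>\<^bsub>G\<^esub> g)"
      by blast
    then have "s \<in> carrier G"
      using S by blast
    then have "g \<otimes>\<^bsub>G\<^esub> inv\<^bsub>G\<^esub> (inv\<^bsub>G\<^esub> s \<otimes>\<^bsub>G\<^esub> g) = s"
      using assms(3) by (simp add: inv_mult_group m_assoc[symmetric])
    with s \<open>s \<in> carrier G\<close> assms(3) show "e \<in> out_arcs (cayley_graph G S) g"
      by (simp add: cayley_graph_def)
  qed
  moreover have "inj_on (\<lambda>s. (g, inv\<^bsub>G\<^esub> s \<otimes>\<^bsub>G\<^esub> g)) S"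
  proof (rule inj_onI)
    fix s t assume *: "s \<in> S" "t \<in> S" "(g, inv\<^bsub>G\<^esub> s \<otimes>\<^bsub>G\<^esub> g) = (g, inv\<^bsub>G\<^esub> t \<otimes>\<^bsub>G\<^esub> g)"
    then have "s \<in> carrier G" "t \<in> carrier G"
      using S by auto
    moreover from this * assms(3) have "inv\<^bsub>G\<^esub> s = inv\<^bsub>G\<^esub> t"
      by simp
    ultimately show "s = t"
      using inv_inv by metis
  qed
  ultimately show ?thesis
    by (simp add: out_degree_def card_image)
qed

text \<open>
  With unit weights, \<^const>\<open>wf_digraph.\<mu>\<close> is the graph distance; it is infinite between vertices
  in different components.
\<close>

definition diameter :: "('a, 'b) pre_digraph \<Rightarrow> ereal" where
  "diameter \<Gamma> = (SUP (u, v) \<in> verts \<Gamma> \<times> verts \<Gamma>. wf_digraph.\<mu> \<Gamma> (\<lambda>_. 1) u v)"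

section \<open>The degree-diameter problem for dihedral groups\<close>

definition DC_orders :: "nat \<Rightarrow> nat \<Rightarrow> nat set" where
  "DC_orders d k =
     {card (verts (cayley_graph (dihedral_group m) S)) | m S.
        m > 0 \<and> cayley_set (dihedral_group m) S \<and>
        regular_of_degree (cayley_graph (dihedral_group m) S) d \<and>
        diameter (cayley_graph (dihedral_group m) S) = ereal (real k)}"

definition DC :: "nat \<Rightarrow> nat \<Rightarrow> nat" where
  "DC d k = Max (DC_orders d k)"

lemma card_cayley_graph_le:
  assumes "group G" and "finite (carrier G)" and "cayley_set G S"
    and diam: "diameter (cayley_graph G S) \<le> ereal (real k)"
  shows "card (verts (cayley_graph G S)) \<le> (\<Sum>i\<le>k. card S ^ i)"
proof -
  interpret group G by fact
  interpret graph "cayley_graph G S"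
    using assms by (intro graph_cayley_graph)
  have S: "S \<subseteq> carrier G"
    using assms(3) by (simp add: cayley_set_def)
  then have "finite S"
    using assms(2) finite_subset by blast
  let ?f = "\<lambda>xs. fold (\<lambda>s g. inv\<^bsub>G\<^esub> s \<otimes>\<^bsub>G\<^esub> g) xs \<one>\<^bsub>G\<^esub>"
  let ?L = "{xs. set xs \<subseteq> S \<and> length xs \<le> k}"
  have walk: "\<exists>xs. set xs \<subseteq> S \<and> length xs = length p \<and>
      v = fold (\<lambda>s g. inv\<^bsub>G\<^esub> s \<otimes>\<^bsub>G\<^esub> g) xs u" if "awalk u p v" for u p v
    using that
  proof (induction p arbitrary: u)
    case Nil
    then show ?case by (auto simp: awalk_Nil_iff)
  next
    case (Cons e p)
    then have e: "e \<in> arcs (cayley_graph G S)" "u = tail (cayley_graph G S) e"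
        and walk: "awalk (head (cayley_graph G S) e) p v"
      by (simp_all add: awalk_Cons_iff)
    from e obtain h where h: "e = (u, h)" "u \<in> carrier G" "h \<in> carrier G"
        "u \<otimes>\<^bsub>G\<^esub> inv\<^bsub>G\<^esub> h \<in> S"
      by (auto simp: cayley_graph_def)
    then have "head (cayley_graph G S) e = h"
      by (simp add: cayley_graph_def)
    with walk have p: "awalk h p v"
      by metis
    from Cons.IH[OF p] obtain xs where xs: "set xs \<subseteq> S" "length xs = length p"
        "v = fold (\<lambda>s g. inv\<^bsub>G\<^esub> s \<otimes>\<^bsub>G\<^esub> g) xs h"
      by blast
    have "inv\<^bsub>G\<^esub> (u \<otimes>\<^bsub>G\<^esub> inv\<^bsub>G\<^esub> h) \<otimes>\<^bsub>G\<^esub> u = h"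
      using h by (simp add: inv_mult_group m_assoc)
    then show ?case
      using xs h(4) by (intro exI[of _ "(u \<otimes>\<^bsub>G\<^esub> inv\<^bsub>G\<^esub> h) # xs"]) simp
  qed
  have cost: "awalk_cost (\<lambda>_. 1) p = real (length p)" for p
    by (induction p) auto
  have "carrier G \<subseteq> ?f ` ?L"
  proof
    fix v assume v: "v \<in> carrier G"
    have "\<mu> (\<lambda>_. 1) \<one>\<^bsub>G\<^esub> v \<le> diameter (cayley_graph G S)"
      unfolding diameter_def
      by (rule SUP_upper2[of "(\<one>\<^bsub>G\<^esub>, v)"]) (use v in \<open>auto simp: cayley_graph_def\<close>)
    with diam have le: "\<mu> (\<lambda>_. 1) \<one>\<^bsub>G\<^esub> v \<le> ereal (real k)"
      by (rule order_trans[rotated])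
    then have "\<mu> (\<lambda>_. 1) \<one>\<^bsub>G\<^esub> v < \<infinity>"
      by (rule le_less_trans) simp
    then have "\<one>\<^bsub>G\<^esub> \<rightarrow>\<^sup>*\<^bsub>cayley_graph G S\<^esub> v"
      by (simp only: \<mu>_reach_conv)
    then obtain p where p: "apath \<one>\<^bsub>G\<^esub> p v"
        "\<mu> (\<lambda>_. 1) \<one>\<^bsub>G\<^esub> v = awalk_cost (\<lambda>_. 1) p"
      using min_cost_awalk[of "\<one>\<^bsub>G\<^esub>" v "\<lambda>_. 1"] by auto
    then have "length p \<le> k" and "awalk \<one>\<^bsub>G\<^esub> p v"
      using le cost by (auto simp: apath_def)
    then show "v \<in> ?f ` ?L"
      using walk[of "\<one>\<^bsub>G\<^esub>" p v] by auto
  qed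
  then have "card (carrier G) \<le> card (?f ` ?L)"
    by (rule card_mono[rotated]) (simp add: finite_lists_length_le \<open>finite S\<close>)
  also have "\<dots> \<le> card ?L"
    by (rule card_image_le) (simp add: finite_lists_length_le \<open>finite S\<close>)
  also have "\<dots> = (\<Sum>i\<le>k. card S ^ i)"
    by (rule card_lists_length_le[OF \<open>finite S\<close>])
  finally show ?thesis
    by (simp add: cayley_graph_def)
qed

lemma finite_DC_orders: "finite (DC_orders d k)"
proof (rule finite_subset)
  show "DC_orders d k \<subseteq> {..\<Sum>i\<le>k. d ^ i}"
  proof
    fix n assume "n \<in> DC_orders d k"
    then obtain m S where m: "m > 0" and S: "cayley_set (dihedral_group m) S"
      and n: "n = card (verts (cayley_graph (dihedral_group m) S))"
      and reg: "regular_of_degree (cayley_graph (dihedral_group m) S) d"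
      and diam: "diameter (cayley_graph (dihedral_group m) S) = ereal (real k)"
      by (auto simp: DC_orders_def)
    have fin: "finite (carrier (dihedral_group m))"
      using m by (simp add: carrier_dihedral_group carrier_integer_mod_group)
    have one: "\<one>\<^bsub>dihedral_group m\<^esub> \<in> carrier (dihedral_group m)"
      using group_dihedral_group[OF m] by (simp add: group.is_monoid monoid.one_closed)
    have "card S = d"
      using out_degree_cayley_graph[OF group_dihedral_group[OF m] S one] reg one
      by (auto simp: regular_of_degree_def cayley_graph_def)
    with card_cayley_graph_le[OF group_dihedral_group[OF m] fin S] diam n
    show "n \<in> {..\<Sum>i\<le>k. d ^ i}"
      by simp
  qed
qed simp

end

theory Submission
  imports Defs "HOL-Number_Theory.Residue_Primitive_Roots"
begin

text \<open>
  Take \<open>m = p (p - 1)\<close>, so that \<open>\<int>\<^sub>m \<cong> \<int>\<^sub>p \<times> \<int>\<^sub>p\<^sub>-\<^sub>1\<close>, and build the generating set from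
  rotations \<open>(a, 1)\<close> with \<open>a \<in> A\<close> and reflections \<open>(b, -1)\<close> with \<open>b \<in> B\<close>. A product of two such
  reflections is the rotation by \<open>b - b'\<close>, and a rotation times a reflection is the reflection in
  \<open>a + b\<close>. Diameter two therefore means that \<open>A + A\<close> and \<open>B - B\<close> together cover all rotations,
  and \<open>A + B\<close> covers all reflections, with \<open>0\<close> adjoined to \<open>A\<close>.

  For \<open>B\<close> take the graph \<open>{(g\<^sup>i, i)}\<close> of a discrete exponential, with \<open>g\<close> a primitive root
  modulo \<open>p\<close>. It has \<open>p - 1\<close> points, and it is a relative difference set: solving
  \<open>g\<^sup>j (g\<^sup>k - 1) = y\<close> for \<open>j\<close> shows that its differences are all the pairs \<open>(y, k)\<close> with both
  coordinates nonzero (\<open>exp_graph_difference\<close>).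

  The set \<open>A\<close> has to deal with the two coordinate axes. The \<open>p - 1\<close> nonzero points of
  \<open>\<int>\<^sub>p \<times> 0\<close> are put into \<open>A\<close>. As \<open>B\<close> meets every coset of this subgroup, they also take care of
  the reflections. On the other axis, cyclic of order \<open>p - 1\<close>, a symmetric set of \<open>2 \<lceil>\<surd>p\<rceil>\<close>
  elements suffices: every residue is the sum of a small integer and a multiple of a fixed step
  (\<open>two_scale_basis\<close>).

  Altogether this takes at most \<open>2 (p - 1) + 2 \<lceil>\<surd>p\<rceil> = d\<close> generators. As reflections are
  involutions, any number of them may be added to reach the degree \<open>d\<close> exactly, as long as
  there are enough of them. This fails only for \<open>p = 2\<close>, where no graph of order 4 has
  degree 6; a dihedral group of order 8 does the job there.
\<close>

section \<open>Cayley graphs of diameter two\<close>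

text \<open>
  If \<open>u v\<inverse> = s t\<close> then \<open>u, t v, v\<close> is a walk. Adjoining the identity to \<open>S\<close> covers the
  shorter walks by the same equation.
\<close>

lemma diameter_cayley_graph_le_2:
  assumes "group G" and "finite (carrier G)" and "cayley_set G S"
    and cover: "\<And>g. g \<in> carrier G \<Longrightarrow> \<exists>s \<in> insert \<one>\<^bsub>G\<^esub> S. \<exists>t \<in> insert \<one>\<^bsub>G\<^esub> S. g = s \<otimes>\<^bsub>G\<^esub> t"
  shows "diameter (cayley_graph G S) \<le> 2"
proof -
  interpret group G by fact
  interpret graph "cayley_graph G S"
    using assms by (intro graph_cayley_graph)
  have S: "S \<subseteq> carrier G"
    using assms(3) by (simp add: cayley_set_def)
  note nodes = awalk_Nil_iff awalk_Cons_iff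
  have verts: "verts (cayley_graph G S) = carrier G"
    and arcs: "(u, v) \<in> arcs (cayley_graph G S) \<longleftrightarrow>
      u \<in> carrier G \<and> v \<in> carrier G \<and> u \<otimes>\<^bsub>G\<^esub> inv\<^bsub>G\<^esub> v \<in> S"
    and ends: "tail (cayley_graph G S) = fst" "head (cayley_graph G S) = snd" for u v
    by (simp_all add: cayley_graph_def)
  have step: "\<exists>q. awalk (s \<otimes>\<^bsub>G\<^esub> v) q v \<and> awalk_cost (\<lambda>_. 1) q \<le> 1"
    if v: "v \<in> carrier G" and s: "s \<in> insert \<one>\<^bsub>G\<^esub> S" for v s
  proof (cases "s = \<one>\<^bsub>G\<^esub>")
    case True
    then show ?thesis
      using v by (intro exI[of _ "[]"]) (simp add: nodes verts)
  next
    case False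
    with s S have "s \<in> S" "s \<in> carrier G" by auto
    then show ?thesis
      using v
      by (intro exI[of _ "[(s \<otimes>\<^bsub>G\<^esub> v, v)]"])
        (simp add: nodes verts arcs ends m_assoc)
  qed
  have "\<mu> (\<lambda>_. 1) u v \<le> 2" if u: "u \<in> carrier G" and v: "v \<in> carrier G" for u v
  proof -
    have uv: "u \<otimes>\<^bsub>G\<^esub> inv\<^bsub>G\<^esub> v \<in> carrier G" using u v by simp
    obtain s t where st: "s \<in> insert \<one>\<^bsub>G\<^esub> S" "t \<in> insert \<one>\<^bsub>G\<^esub> S" "u \<otimes>\<^bsub>G\<^esub> inv\<^bsub>G\<^esub> v = s \<otimes>\<^bsub>G\<^esub> t"
      using cover[OF uv] by blast
    have c: "s \<in> carrier G" "t \<in> carrier G" using st S by auto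
    have "u = u \<otimes>\<^bsub>G\<^esub> inv\<^bsub>G\<^esub> v \<otimes>\<^bsub>G\<^esub> v" using u v by (simp add: m_assoc)
    then have u_eq: "u = s \<otimes>\<^bsub>G\<^esub> (t \<otimes>\<^bsub>G\<^esub> v)" using st(3) c v by (simp add: m_assoc)
    obtain q where q: "awalk u q (t \<otimes>\<^bsub>G\<^esub> v)" "awalk_cost (\<lambda>_. 1) q \<le> 1"
      using step[of "t \<otimes>\<^bsub>G\<^esub> v" s] st(1) c v unfolding u_eq by auto
    obtain q' where q': "awalk (t \<otimes>\<^bsub>G\<^esub> v) q' v" "awalk_cost (\<lambda>_. 1) q' \<le> 1"
      using step[OF v st(2)] by auto
    have "\<mu> (\<lambda>_. 1) u v \<le> ereal (awalk_cost (\<lambda>_. 1) (q @ q'))"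
      by (intro min_cost_le_walk_cost awalk_appendI[OF q(1) q'(1)])
    also have "\<dots> \<le> ereal 2" using q(2) q'(2) by simp
    finally show ?thesis by simp
  qed
  then show ?thesis
    unfolding diameter_def by (intro SUP_least) (auto simp: cayley_graph_def)
qed

text \<open>
  Some vertex is neither the identity nor one of its neighbours.
\<close>

lemma diameter_cayley_graph_ge_2:
  assumes "group G" and "finite (carrier G)" and "cayley_set G S"
    and card: "card S + 1 < order G"
  shows "2 \<le> diameter (cayley_graph G S)"
proof -
  interpret group G by fact
  interpret graph "cayley_graph G S"
    using assms by (intro graph_cayley_graph)
  have S: "S \<subseteq> carrier G"
    using assms(3) by (simp add: cayley_set_def)
  have "card (insert \<one>\<^bsub>G\<^esub> S) < card (carrier G)"
    using card card_insert_le_m1[of "card S + 1" S "\<one>\<^bsub>G\<^esub>"] by (simp add: order_def)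
  then have "\<not> carrier G \<subseteq> insert \<one>\<^bsub>G\<^esub> S"
    using assms(2) S by (metis card_mono finite.insertI finite_subset not_less)
  then obtain g where g: "g \<in> carrier G" "g \<noteq> \<one>\<^bsub>G\<^esub>" "g \<notin> S"
    by blast
  have ends: "tail (cayley_graph G S) = fst" "head (cayley_graph G S) = snd"
    by (simp_all add: cayley_graph_def)
  have "2 \<le> awalk_cost (\<lambda>_. 1) q" if q: "awalk g q \<one>\<^bsub>G\<^esub>" for q
  proof -
    consider "q = []" | e where "q = [e]" | e f r where "q = e # f # r"
      by (metis list.exhaust)
    then show ?thesis
    proof cases
      case 1 then show ?thesis using q g by (simp add: awalk_Nil_iff)
    next
      case 2
      then have "(g, \<one>\<^bsub>G\<^esub>) \<in> arcs (cayley_graph G S)"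
        using q by (cases e) (simp add: awalk_Cons_iff awalk_Nil_iff ends)
      then show ?thesis using g by (simp add: cayley_graph_def)
    next
      case 3
      have "0 \<le> awalk_cost (\<lambda>_. 1) r" by (induction r) auto
      then show ?thesis using 3 by simp
    qed
  qed
  then have "2 \<le> \<mu> (\<lambda>_. 1) g \<one>\<^bsub>G\<^esub>"
    unfolding \<mu>_def by (intro INF_greatest) simp
  also have "\<dots> \<le> diameter (cayley_graph G S)"
    unfolding diameter_def
    by (rule SUP_upper2[of "(g, \<one>\<^bsub>G\<^esub>)"]) (use g in \<open>auto simp: cayley_graph_def\<close>)
  finally show ?thesis .
qed

section \<open>Generating sets of dihedral groups\<close>

text \<open>
  The covering conditions survive when \<open>B\<close> is enlarged, and every set of reflections is
  inverse-closed; this is what allows \<open>d\<close> to exceed \<open>card A + card B\<close>. The bound \<open>d + 1 < 2 * m\<close>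
  keeps the graph from being complete.
\<close>

lemma DC_orders_2_I:
  fixes A B :: "int set"
  assumes m: "m > 0"
    and A: "A \<subseteq> {1..<int m}" and A_sym: "\<And>a. a \<in> A \<Longrightarrow> int m - a \<in> A"
    and B: "B \<subseteq> {0..<int m}"
    and d: "card A + card B \<le> d" "d \<le> card A + m" "d + 1 < 2 * m"
    and rot: "\<And>x. x \<in> {0..<int m} \<Longrightarrow>
      (\<exists>a \<in> insert 0 A. \<exists>a' \<in> insert 0 A. [x = a + a'] (mod int m)) \<or>
      (\<exists>b \<in> B. \<exists>b' \<in> B. [x = b - b'] (mod int m))"
    and ref: "\<And>x. x \<in> {0..<int m} \<Longrightarrow>
      \<exists>a \<in> insert 0 A. \<exists>b \<in> B. [x = a + b] (mod int m)"
  shows "2 * m \<in> DC_orders d 2"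
proof -
  have "card B \<le> d - card A" "d - card A \<le> card {0..<int m}"
    using d(1,2) by (simp_all add: le_diff_conv add.commute)
  then obtain C where C: "B \<subseteq> C" "C \<subseteq> {0..<int m}" "card C = d - card A"
    using exists_subset_between[OF _ _ B] by (metis finite_atLeastLessThan_int)
  define G where "G = dihedral_group m"
  define S where "S = A \<times> {1} \<union> C \<times> {-1::int}"
  interpret group G unfolding G_def by (rule group_dihedral_group[OF m])
  have Z: "carrier (integer_mod_group m) = {0..<int m}"
    using m by (simp add: carrier_integer_mod_group)
  have carr: "carrier G = {0..<int m} \<times> {-1, 1}"
    by (simp add: G_def carrier_dihedral_group Z)
  have one: "\<one>\<^bsub>G\<^esub> = (0, 1)" by (simp add: G_def one_dihedral_group)
  have mult: "(x, s) \<otimes>\<^bsub>G\<^esub> (y, t) = ((x + s * y) mod int m, s * t)"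
    if "y \<in> {0..<int m}" "s \<in> {-1, 1}" for x y s t
    using that unfolding G_def by (intro mult_dihedral_group) (simp_all add: Z)
  have fin: "finite (carrier G)" by (simp add: carr)
  have finAC: "finite A" "finite C"
    using A C(2) finite_subset by blast+
  have "inv\<^bsub>G\<^esub> s \<in> S" if "s \<in> S" for s
  proof -
    from that consider a where "s = (a, 1)" "a \<in> A" | c where "s = (c, -1)" "c \<in> C"
      by (auto simp: S_def)
    then show ?thesis
    proof cases
      case 1
      with A A_sym[of a] have a: "a \<in> {1..<int m}" "int m - a \<in> {1..<int m}" by auto
      have "inv\<^bsub>G\<^esub> s = (int m - a, 1)"
        using a 1 by (intro inv_equality) (auto simp: mult carr one)
      then show ?thesis using A_sym 1 by (simp add: S_def)
    next
      case 2
      with C(2) have c: "c \<in> {0..<int m}" by auto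
      have "inv\<^bsub>G\<^esub> s = s"
        using c 2 by (intro inv_equality) (auto simp: mult carr one)
      then show ?thesis using that by simp
    qed
  qed
  moreover have "S \<subseteq> carrier G" using A C(2) by (auto simp: S_def carr)
  moreover have "\<one>\<^bsub>G\<^esub> \<notin> S" using A by (auto simp: S_def one)
  ultimately have cay: "cayley_set G S" by (simp add: cayley_set_def)
  have "card S = card (A \<times> {1::int}) + card (C \<times> {-1::int})"
    unfolding S_def using finAC by (intro card_Un_disjoint) auto
  then have cardS: "card S = d"
    using C(3) d(1) by (simp add: card_cartesian_product)
  have order: "order G = 2 * m" unfolding G_def by (rule order_dihedral_group[OF m])
  have cover: "\<exists>s \<in> insert \<one>\<^bsub>G\<^esub> S. \<exists>t \<in> insert \<one>\<^bsub>G\<^esub> S. g = s \<otimes>\<^bsub>G\<^esub> t" if "g \<in> carrier G" for g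
  proof -
    have rotS: "(a, 1) \<in> insert \<one>\<^bsub>G\<^esub> S" "a \<in> {0..<int m}" if "a \<in> insert 0 A" for a
      using that A m by (auto simp: S_def one)
    have refS: "(b, -1) \<in> insert \<one>\<^bsub>G\<^esub> S" "b \<in> {0..<int m}" if "b \<in> B" for b
      using that C by (auto simp: S_def)
    from that obtain x where x: "x \<in> {0..<int m}" "x mod int m = x" "g = (x, 1) \<or> g = (x, -1)"
      by (auto simp: carr)
    from x(3) show ?thesis
    proof
      assume g: "g = (x, 1)"
      from rot[OF x(1)] show ?thesis
      proof (elim disjE bexE)
        fix a a' assume *: "a \<in> insert 0 A" "a' \<in> insert 0 A" "[x = a + a'] (mod int m)"
        then have "g = (a, 1) \<otimes>\<^bsub>G\<^esub> (a', 1)"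
          using x(2) g rotS(2) by (simp add: mult cong_def)
        then show ?thesis using rotS(1) * by blast
      next
        fix b b' assume *: "b \<in> B" "b' \<in> B" "[x = b - b'] (mod int m)"
        then have "g = (b, -1) \<otimes>\<^bsub>G\<^esub> (b', -1)"
          using x(2) g refS(2) by (simp add: mult cong_def)
        then show ?thesis using refS(1) * by blast
      qed
    next
      assume g: "g = (x, -1)"
      from ref[OF x(1)] obtain a b where *: "a \<in> insert 0 A" "b \<in> B" "[x = a + b] (mod int m)"
        by blast
      then have "g = (a, 1) \<otimes>\<^bsub>G\<^esub> (b, -1)"
        using x(2) g refS(2) by (simp add: mult cong_def)
      then show ?thesis using rotS(1) refS(1) * by blast
    qed
  qed
  have "diameter (cayley_graph G S) = 2"
    using diameter_cayley_graph_le_2[OF is_group fin cay cover]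
      diameter_cayley_graph_ge_2[OF is_group fin cay] cardS order d(3) by (simp add: antisym)
  moreover have "regular_of_degree (cayley_graph G S) d"
    using out_degree_cayley_graph[OF is_group cay] cardS
    by (simp add: regular_of_degree_def cayley_graph_def)
  moreover have "card (verts (cayley_graph G S)) = 2 * m"
    using order by (simp add: cayley_graph_def order_def)
  ultimately show ?thesis
    using m cay unfolding DC_orders_def G_def by force
qed

section \<open>The graph of the discrete exponential\<close>

text \<open>
  The pairs \<open>(g\<^sup>i mod p, i)\<close> correspond under the Chinese remainder theorem to the \<open>x\<close> modulo
  \<open>p (p - 1)\<close> with \<open>x \<equiv> g\<^sup>x\<close> modulo \<open>p\<close>, because \<open>g\<^sup>x\<close> depends only on \<open>x\<close> modulo \<open>p - 1\<close>. This
  form of the set needs no explicit isomorphism.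
\<close>

lemma exp_graph_meets_class:
  fixes p g :: nat
  assumes "prime p" and "residue_primroot p g"
  obtains x where "x \<in> {0..<int (p * (p - 1))}" "[x = int (g ^ nat x)] (mod int p)"
    "[x = int j] (mod int (p - 1))" "[x = int (g ^ j)] (mod int p)"
proof -
  have p: "p > 1" using assms(1) prime_gt_1_nat by blast
  have ord: "ord p g = p - 1" "coprime p g"
    using assms by (auto simp: residue_primroot_def totient_prime)
  have "coprime p (p - 1)"
    using p by (metis coprime_commute coprime_diff_one_left_nat gr0I less_nat_zero_code less_zeroE)
  then obtain x where x: "x < p * (p - 1)" "[x = g ^ j] (mod p)" "[x = j] (mod (p - 1))"
    using binary_chinese_remainder_unique_nat[of p "p - 1" "g ^ j" j] p by auto
  have "[g ^ x = g ^ j] (mod p)"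
    using x(3) order_divides_expdiff[OF ord(2)] ord(1) by simp
  then have "[x = g ^ x] (mod p)"
    using x(2) by (metis cong_sym cong_trans)
  with x show ?thesis
    by (intro that[of "int x"]) (simp_all only: nat_int cong_int_iff, auto simp del: of_nat_mult)
qed

text \<open>
  A point of the graph is determined by its class modulo \<open>p - 1\<close>.
\<close>

lemma card_exp_graph_le:
  fixes p g :: nat
  assumes "prime p" and "residue_primroot p g"
  shows "card {x \<in> {0..<int (p * (p - 1))}. [x = int (g ^ nat x)] (mod int p)} \<le> p - 1"
    (is "card ?D \<le> _")
proof -
  have p: "p > 1" using assms(1) prime_gt_1_nat by blast
  have ord: "ord p g = p - 1" "coprime p g"
    using assms by (auto simp: residue_primroot_def totient_prime)
  have cop: "coprime (int p) (int (p - 1))"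
    using p by (metis coprime_commute coprime_diff_one_left_nat coprime_int_iff gr0I less_zeroE)
  have "inj_on (\<lambda>x. x mod int (p - 1)) ?D"
  proof (rule inj_onI)
    fix x y assume x: "x \<in> ?D" and y: "y \<in> ?D" and eq: "x mod int (p - 1) = y mod int (p - 1)"
    have "[nat x = nat y] (mod (p - 1))"
      using eq x y by (simp flip: cong_int_iff add: cong_def)
    then have "[g ^ nat x = g ^ nat y] (mod p)"
      using order_divides_expdiff[OF ord(2)] ord(1) by simp
    then have "[x = y] (mod int p)"
      using x y cong_int_iff by (metis (mono_tags, lifting) cong_sym cong_trans mem_Collect_eq)
    moreover have "[x = y] (mod int (p - 1))" using eq by (simp add: cong_def)
    ultimately have "[x = y] (mod int p * int (p - 1))"
      using cop by (intro coprime_cong_mult)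
    then show "x = y" using x y by (auto simp: cong_def simp flip: of_nat_mult)
  qed
  then have "card ?D = card ((\<lambda>x. x mod int (p - 1)) ` ?D)" by (simp add: card_image)
  also have "\<dots> \<le> card {0..<int (p - 1)}"
    using p by (intro card_mono) auto
  finally show ?thesis by simp
qed

text \<open>
  With \<open>k \<equiv> x\<close> modulo \<open>p - 1\<close>, the point \<open>j + k\<close> of the graph minus the point \<open>j\<close> has second
  coordinate \<open>k\<close> and first coordinate \<open>g\<^sup>j (g\<^sup>k - 1)\<close>. Since \<open>k\<close> is nonzero, \<open>g\<^sup>k - 1\<close> is a unit modulo
  \<open>p\<close>; since \<open>g\<close> generates the units, \<open>j\<close> can be chosen to make the first coordinate any given
  unit.
\<close>

lemma exp_graph_difference:
  fixes p g :: nat and x :: int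
  defines "D \<equiv> {x \<in> {0..<int (p * (p - 1))}. [x = int (g ^ nat x)] (mod int p)}"
  assumes "prime p" and "residue_primroot p g"
    and x: "\<not> int p dvd x" "\<not> int (p - 1) dvd x"
  shows "\<exists>b \<in> D. \<exists>b' \<in> D. [x = b - b'] (mod int (p * (p - 1)))"
proof -
  have p: "p > 1" using assms(2) prime_gt_1_nat by blast
  have ord: "ord p g = p - 1" "coprime p g"
    using assms(2,3) by (auto simp: residue_primroot_def totient_prime)
  have cop: "coprime (int p) (int (p - 1))"
    using p by (metis coprime_commute coprime_diff_one_left_nat coprime_int_iff gr0I less_zeroE)
  define k where "k = nat (x mod int (p - 1))"
  have k: "int k = x mod int (p - 1)" using p by (simp add: k_def)
  have "\<not> (p - 1) dvd k"
    using x(2) k by (metis dvd_mod_iff dvd_refl int_dvd_int_iff)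
  then have "\<not> [g ^ k = 1] (mod p)"
    using ord by (metis ord_divides)
  then have "\<not> int p dvd int (g ^ k) - 1"
    by (metis cong_iff_dvd_diff cong_int_iff of_nat_1)
  moreover have prime_p: "prime (int p)" using assms(2) by simp
  ultimately have "coprime (int (g ^ k) - 1) (int p)"
    using prime_imp_coprime coprime_commute by blast
  then obtain c where c: "[(int (g ^ k) - 1) * c = 1] (mod int p)"
    using cong_solve_coprime_int by blast
  have "\<not> int p dvd c * x"
  proof
    assume "int p dvd c * x"
    then have "int p dvd c" using x(1) prime_p prime_dvd_mult_iff by blast
    then have "[(int (g ^ k) - 1) * c = 0] (mod int p)" by (simp add: cong_0_iff)
    with c have "[0 = 1] (mod int p)" by (metis cong_sym cong_trans)
    then show False using p by (simp add: cong_def)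
  qed
  \<comment> \<open>\<open>y\<close> is \<open>x / (g\<^sup>k - 1)\<close> modulo \<open>p\<close>, the value needed for \<open>g\<^sup>j\<close>.\<close>
  define y where "y = nat ((c * x) mod int p)"
  have y: "int y = (c * x) mod int p" using p by (simp add: y_def)
  have "int y \<noteq> 0" using y \<open>\<not> int p dvd c * x\<close> by (simp add: dvd_eq_mod_eq_0)
  moreover have "int y < int p" using p unfolding y by (intro pos_mod_bound) simp
  ultimately have "y \<noteq> 0" "y < p" by simp_all
  then have "y \<in> totatives p"
    using assms(2) by (simp add: totatives_prime)
  then obtain j where "y = g ^ j mod p"
    using residue_primroot_is_generator[OF p assms(3)] by (auto simp: bij_betw_def)
  then have j: "[int (g ^ j) = c * x] (mod int p)"
    using y by (simp add: cong_def zmod_int)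
  obtain b where b: "b \<in> D" "[b = int j] (mod int (p - 1))" "[b = int (g ^ j)] (mod int p)"
    using exp_graph_meets_class[OF assms(2,3), of j] unfolding D_def by blast
  obtain b' where b': "b' \<in> D" "[b' = int (j + k)] (mod int (p - 1))"
      "[b' = int (g ^ (j + k))] (mod int p)"
    using exp_graph_meets_class[OF assms(2,3), of "j + k"] unfolding D_def by blast
  have "[b' - b = int (j + k) - int j] (mod int (p - 1))"
    using b b' by (intro cong_diff)
  then have 1: "[x = b' - b] (mod int (p - 1))"
    using k by (simp add: cong_def)
  have "[b' - b = int (g ^ (j + k)) - int (g ^ j)] (mod int p)"
    using b b' by (intro cong_diff)
  also have "int (g ^ (j + k)) - int (g ^ j) = (int (g ^ k) - 1) * int (g ^ j)"
    by (simp add: power_add algebra_simps)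
  also have "[(int (g ^ k) - 1) * int (g ^ j) = (int (g ^ k) - 1) * (c * x)] (mod int p)"
    by (intro cong_mult j cong_refl)
  also have "(int (g ^ k) - 1) * (c * x) = (int (g ^ k) - 1) * c * x" by simp
  also have "[(int (g ^ k) - 1) * c * x = 1 * x] (mod int p)"
    by (intro cong_mult c cong_refl)
  finally have 2: "[x = b' - b] (mod int p)" by (simp add: cong_sym)
  from 2 1 cop have "[x = b' - b] (mod int p * int (p - 1))"
    by (rule coprime_cong_mult)
  then show ?thesis using b b' by (auto simp only: of_nat_mult)
qed

section \<open>A small basis for a cyclic group\<close>

text \<open>
  Division by \<open>2 a + 1\<close> with a remainder of least absolute value: the intervals of radius \<open>a\<close>
  around the multiples of \<open>2 a + 1\<close> tile the integers, and the \<open>2 b + 1\<close> of them around \<open>0\<close> reach up to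
  \<open>((2 a + 1) (2 b + 1) - 1) / 2\<close>, the bound on \<open>t\<close>.
\<close>

lemma two_scale_expansion:
  fixes t :: int and a b :: nat
  assumes "\<bar>t\<bar> \<le> 2 * int a * int b + int a + int b"
  obtains u v where "\<bar>u\<bar> \<le> int a" "\<bar>v\<bar> \<le> int b" "t = u + (2 * int a + 1) * v"
proof
  let ?n = "2 * int a + 1"
  let ?v = "(t + int a) div ?n"
  show "t = ((t + int a) mod ?n - int a) + ?n * ?v"
    using mult_div_mod_eq[of ?n "t + int a"] by linarith
  show "\<bar>(t + int a) mod ?n - int a\<bar> \<le> int a"
    using pos_mod_bound[of ?n "t + int a"] pos_mod_sign[of ?n "t + int a"] by linarith
  have "?n * ?v \<le> t + int a"
    using mult_div_mod_eq[of ?n "t + int a"] pos_mod_sign[of ?n "t + int a"] by linarith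
  also have "\<dots> < ?n * (int b + 1)"
    using assms by (simp add: algebra_simps)
  finally have "?v < int b + 1" by (simp add: mult_less_cancel_left)
  moreover have "- int b \<le> ?v"
  proof -
    have "?n * (- int b) \<le> t + int a" using assms by (simp add: algebra_simps)
    also have "\<dots> < ?n * (?v + 1)"
      using mult_div_mod_eq[of ?n "t + int a"] pos_mod_bound[of ?n "t + int a"]
      unfolding distrib_left mult_1_right by linarith
    finally have "- int b < ?v + 1" by (simp only: mult_less_cancel_left)
    then show ?thesis by simp
  qed
  ultimately show "\<bar>?v\<bar> \<le> int b" by linarith
qed

lemma balanced_residue:
  fixes n h t :: int
  assumes "0 < n" "n \<le> 2 * h + 1"
  obtains s where "\<bar>s\<bar> \<le> h" "[s = t] (mod n)"
proof
  show "\<bar>(t + h) mod n - h\<bar> \<le> h"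
    using assms pos_mod_bound[of n "t + h"] pos_mod_sign[of n "t + h"] by linarith
  show "[(t + h) mod n - h = t] (mod n)"
    by (simp add: cong_def mod_simps)
qed

text \<open>
  The radii \<open>a\<close> and \<open>b\<close> of the two progressions add up to \<open>r\<close>, which bounds the size by \<open>2 r\<close>
  besides \<open>0\<close>; splitting \<open>r\<close> evenly maximises the number \<open>(2 a + 1) (2 b + 1)\<close> of sums.
\<close>

definition two_scale :: "nat \<Rightarrow> int set" where
  "two_scale r = (let a = int ((r + 1) div 2); b = int (r div 2) in
     {-a..a} \<union> (\<lambda>v. (2 * a + 1) * v) ` {-b..b})"

lemma two_scale_uminus: "u \<in> two_scale r \<Longrightarrow> - u \<in> two_scale r"
  unfolding two_scale_def Let_def
  by (auto simp: image_iff intro: bexI[of _ "- _"])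

lemma finite_two_scale: "finite (two_scale r)"
  by (simp add: two_scale_def Let_def)

lemma card_two_scale_le: "card (two_scale r - {0}) \<le> 2 * r"
proof -
  let ?a = "int ((r + 1) div 2)" and ?b = "int (r div 2)"
  have card_nonzero: "card ({- int k..int k} - {0}) = 2 * k" for k
    by (simp add: card_Diff_singleton nat_add_distrib)
  have "two_scale r - {0} \<subseteq> ({-?a..?a} - {0}) \<union> (\<lambda>v. (2 * ?a + 1) * v) ` ({-?b..?b} - {0})"
    by (auto simp: two_scale_def Let_def)
  then have "card (two_scale r - {0}) \<le>
      card (({-?a..?a} - {0}) \<union> (\<lambda>v. (2 * ?a + 1) * v) ` ({-?b..?b} - {0}))"
    by (intro card_mono) auto
  also have "\<dots> \<le> card ({-?a..?a} - {0}) + card ((\<lambda>v. (2 * ?a + 1) * v) ` ({-?b..?b} - {0}))"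
    by (rule card_Un_le)
  also have "\<dots> \<le> card ({-?a..?a} - {0}) + card ({-?b..?b} - {0})"
    by (intro add_left_mono card_image_le) auto
  also have "\<dots> = 2 * ((r + 1) div 2) + 2 * (r div 2)"
    by (simp only: card_nonzero)
  also have "\<dots> = 2 * r" by presburger
  finally show ?thesis .
qed

text \<open>
  The product \<open>(2 a + 1) (2 b + 1)\<close> is \<open>(r + 1)\<^sup>2\<close> for even \<open>r\<close>, but only \<open>r\<^sup>2 + 2 r\<close> for odd \<open>r\<close>.
\<close>

lemma two_scale_basis:
  assumes "0 < n" "n \<le> r\<^sup>2 + 2 * r"
  obtains u v where "u \<in> two_scale r" "v \<in> two_scale r" "[t = u + v] (mod int n)"
proof -
  define a b where "a = (r + 1) div 2" and "b = r div 2"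
  have "r\<^sup>2 + 2 * r \<le> (2 * a + 1) * (2 * b + 1)"
  proof (cases "even r")
    case True
    then obtain k where "r = 2 * k" by blast
    then show ?thesis by (simp add: a_def b_def power2_eq_square algebra_simps)
  next
    case False
    then obtain k where "r = 2 * k + 1" using oddE by blast
    then show ?thesis by (simp add: a_def b_def power2_eq_square algebra_simps)
  qed
  then have "n \<le> 2 * (2 * a * b + a + b) + 1" using assms(2) by (simp add: algebra_simps)
  then have n: "int n \<le> 2 * (2 * int a * int b + int a + int b) + 1"
    by (metis (mono_tags, opaque_lifting) of_nat_1 of_nat_add of_nat_le_iff of_nat_mult of_nat_numeral)
  obtain s where s: "\<bar>s\<bar> \<le> 2 * int a * int b + int a + int b" "[s = t] (mod int n)"
    using balanced_residue[of "int n", OF _ n] assms(1) by auto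
  obtain u v where uv: "\<bar>u\<bar> \<le> int a" "\<bar>v\<bar> \<le> int b" "s = u + (2 * int a + 1) * v"
    using two_scale_expansion[OF s(1)] .
  show ?thesis
  proof
    show "u \<in> two_scale r" 
      using uv unfolding two_scale_def Let_def a_def[symmetric] b_def[symmetric] by auto
    show "(2 * int a + 1) * v \<in> two_scale r"
      using uv(2) unfolding two_scale_def Let_def a_def[symmetric] b_def[symmetric]
      by (intro UnI2 imageI) auto
    show "[t = u + (2 * int a + 1) * v] (mod int n)" using s uv by (simp add: cong_sym)
  qed
qed

section \<open>The construction\<close>

text \<open>
  In the proof \<open>A1\<close> is the axis \<open>\<int>\<^sub>p \<times> 0\<close>, the multiples of \<open>p - 1\<close>, and \<open>A2\<close> is a basis of the
  other axis. The hypothesis \<open>2 * r + p - 1 \<le> p * (p - 1)\<close> says that there are enough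
  reflections to reach degree \<open>d\<close> once the \<open>p - 1\<close> rotations in \<open>A1\<close> are used.
\<close>

lemma DC_orders_prime:
  fixes p r d :: nat
  assumes "prime p" and p3: "p \<ge> 3" and r: "p \<le> r\<^sup>2" "r \<le> p" "2 * r + p - 1 \<le> p * (p - 1)"
    and d: "d = 2 * (p + r - 1)"
  shows "2 * (p * (p - 1)) \<in> DC_orders d 2"
proof -
  define m where "m = p * (p - 1)"
  obtain g where g: "residue_primroot p g"
    using prime_primitive_root_exists[OF _ assms(1)] p3 by auto
  define B where "B = {x \<in> {0..<int m}. [x = int (g ^ nat x)] (mod int p)}"
  define A1 where "A1 = {x \<in> {1..<int m}. int (p - 1) dvd x}"
  define A2 where "A2 = (\<lambda>u. (int p * u) mod int m) ` two_scale r - {0}"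
  have m: "m > 0" using p3 by (simp add: m_def)
  have int_m: "int m = int p * int (p - 1)" by (simp add: m_def)
  have A1_sub: "A1 \<subseteq> (\<lambda>j. int (p - 1) * j) ` {1..<int p}"
  proof
    fix x assume x: "x \<in> A1"
    then obtain j where j: "x = int (p - 1) * j" by (auto simp: A1_def)
    have "0 < int (p - 1) * j" "int (p - 1) * j < int (p - 1) * int p"
      using x j by (auto simp: A1_def int_m mult.commute)
    then have "0 < j" "j < int p"
      using p3 by (auto simp: zero_less_mult_iff mult_less_cancel_left)
    then show "x \<in> (\<lambda>j. int (p - 1) * j) ` {1..<int p}" using j by auto
  qed
  then have cardA1: "card A1 \<le> p - 1"
    using surj_card_le[of "{1..<int p}" A1] p3 by (simp add: nat_diff_distrib)
  have p1_A1: "p - 1 \<le> card A1"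
  proof -
    have "(\<lambda>j. int (p - 1) * j) ` {1..<int p} \<subseteq> A1"
    proof
      fix x assume "x \<in> (\<lambda>j. int (p - 1) * j) ` {1..<int p}"
      then obtain j where j: "x = int (p - 1) * j" "1 \<le> j" "j < int p" by auto
      have "0 < int (p - 1) * j" using j p3 by simp
      moreover have "int (p - 1) * j < int (p - 1) * int p" using j p3 by simp
      ultimately have "x \<in> {1..<int m}"
        unfolding j(1) int_m by (simp add: mult.commute int_one_le_iff_zero_less del: of_nat_diff)
      then show "x \<in> A1" using j(1) by (auto simp: A1_def)
    qed
    moreover have "finite A1" using A1_sub by (rule finite_subset) simp
    ultimately have "card ((\<lambda>j. int (p - 1) * j) ` {1..<int p}) \<le> card A1"
      by (simp add: card_mono)
    moreover have "card ((\<lambda>j. int (p - 1) * j) ` {1..<int p}) = p - 1"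
      using p3 by (subst card_image) (auto simp: inj_on_def nat_diff_distrib)
    ultimately show ?thesis by simp
  qed
  have "A2 \<subseteq> (\<lambda>u. (int p * u) mod int m) ` (two_scale r - {0})"
    by (auto simp: A2_def)
  then have "card A2 \<le> card (two_scale r - {0})"
    using surj_card_le[of "two_scale r - {0}" A2] finite_two_scale by blast
  then have cardA2: "card A2 \<le> 2 * r" using card_two_scale_le order_trans by blast
  have fin: "finite A1" "finite A2"
    using finite_subset[OF A1_sub] by (auto simp: A2_def finite_two_scale)
  have "card (A1 \<union> A2) \<le> p - 1 + 2 * r"
    using card_Un_le[of A1 A2] cardA1 cardA2 by linarith
  moreover have cardB: "card B \<le> p - 1"
    using card_exp_graph_le[OF assms(1) g] by (simp only: B_def m_def)
  ultimately have d1: "card (A1 \<union> A2) + card B \<le> d" using d p3 by linarith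
  have "card A1 \<le> card (A1 \<union> A2)" using fin by (intro card_mono) auto
  with p1_A1 have d2: "d \<le> card (A1 \<union> A2) + m" using d p3 r(3) by (simp add: m_def)
  have "3 * (p - 1) \<le> p * (p - 1)" using p3 by (intro mult_right_mono) auto
  then have d3: "d + 1 < 2 * m" using d r(2,3) p3 unfolding m_def by linarith
  have A2_I: "(int p * u) mod int m \<in> insert 0 (A1 \<union> A2)" if "u \<in> two_scale r" for u
    using that by (auto simp: A2_def)
  show ?thesis unfolding m_def[symmetric]
  proof (rule DC_orders_2_I[where A = "A1 \<union> A2" and B = B, OF m _ _ _ d1 d2 d3])
    have "y mod int m \<in> {1..<int m}" if "y mod int m \<noteq> 0" for y
    proof -
      have "0 \<le> y mod int m" "y mod int m < int m" using m by simp_all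
      with that show ?thesis unfolding atLeastLessThan_iff by linarith
    qed
    then have "A2 \<subseteq> {1..<int m}" by (auto simp only: A2_def)
    then show A: "A1 \<union> A2 \<subseteq> {1..<int m}" by (auto simp only: A1_def)
    show "int m - a \<in> A1 \<union> A2" if "a \<in> A1 \<union> A2" for a
      using that
    proof
      assume "a \<in> A1"
      then show ?thesis by (auto simp: A1_def int_m)
    next
      assume a: "a \<in> A2"
      then obtain u where u: "u \<in> two_scale r" "a = (int p * u) mod int m" "a \<noteq> 0"
        by (auto simp: A2_def)
      have "(int p * (- u)) mod int m = int m - a"
        using u by (simp add: zmod_zminus1_eq_if)
      moreover have "int m - a \<noteq> 0" using a A by auto
      ultimately show ?thesis
        using two_scale_uminus[OF u(1)] unfolding A2_def by force
    qed
    show "B \<subseteq> {0..<int m}" by (auto simp: B_def)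
    fix x assume x: "x \<in> {0..<int m}"
    show "(\<exists>a \<in> insert 0 (A1 \<union> A2). \<exists>a' \<in> insert 0 (A1 \<union> A2). [x = a + a'] (mod int m)) \<or>
        (\<exists>b \<in> B. \<exists>b' \<in> B. [x = b - b'] (mod int m))"
    proof -
      \<comment> \<open>the two axes and the points off both axes\<close>
      consider "int (p - 1) dvd x" | "int p dvd x" | "\<not> int p dvd x" "\<not> int (p - 1) dvd x"
        by blast
      then show ?thesis
      proof cases
        case 1
        then have "x \<in> insert 0 (A1 \<union> A2)" using x by (auto simp: A1_def)
        then show ?thesis by (metis add_0_right cong_refl insertI1)
      next
        case 2
        then obtain t where t: "x = int p * t" by blast
        have "p - 1 \<le> r\<^sup>2 + 2 * r" using r(1) by linarith
        then obtain u v where uv: "u \<in> two_scale r" "v \<in> two_scale r" "[t = u + v] (mod int (p - 1))"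
          using two_scale_basis[of "p - 1" r t] p3 by auto
        have "[int p * t = int p * (u + v)] (mod int p * int (p - 1))"
          using uv(3) by (simp add: cong_iff_dvd_diff flip: right_diff_distrib)
        then have "[x = int p * u + int p * v] (mod int m)"
          by (simp only: t int_m distrib_left)
        then have "[x = int p * u mod int m + int p * v mod int m] (mod int m)"
          by (simp only: cong_def mod_add_eq)
        then show ?thesis using A2_I uv by blast
      next
        case 3
        then show ?thesis
          using exp_graph_difference[OF assms(1) g] by (simp only: B_def m_def) blast
      qed
    qed
    show "\<exists>a \<in> insert 0 (A1 \<union> A2). \<exists>b \<in> B. [x = a + b] (mod int m)"
    proof -
      \<comment> \<open>the point \<open>b\<close> of \<open>B\<close> in the coset \<open>x + (\<int>\<^sub>p \<times> 0)\<close>\<close>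
      obtain b where b: "b \<in> B" "[b = int (nat x)] (mod int (p - 1))"
        using exp_graph_meets_class[OF assms(1) g, of "nat x"] unfolding B_def m_def by blast
      have "int (p - 1) dvd x - b"
        using b(2) x by (simp add: cong_iff_dvd_diff dvd_diff_commute)
      then have "int (p - 1) dvd (x - b) mod int m"
        by (simp add: int_m dvd_mod_iff)
      then have a: "(x - b) mod int m \<in> insert 0 (A1 \<union> A2)"
        using m pos_mod_sign[of "int m" "x - b"] by (auto simp: A1_def simp del: pos_mod_sign)
      have "[x = (x - b) mod int m + b] (mod int m)"
        by (simp add: cong_def mod_simps)
      then show ?thesis by (rule bexI[OF bexI[OF _ b(1)] a])
    qed
  qed
qed

text \<open>
  The case \<open>p = 2\<close>, where \<open>d = 6\<close>: the cocktail party graph on 8 vertices, generated by all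
  reflections and the rotations of order 4.
\<close>

lemma DC_orders_6: "8 \<in> DC_orders 6 2"
proof -
  have "2 * 4 \<in> DC_orders 6 2"
  proof (rule DC_orders_2_I[where A = "{1, 3}" and B = "{0..<4}"])
    fix x :: int assume x: "x \<in> {0..<int 4}"
    then show "(\<exists>a\<in>insert 0 {1, 3}. \<exists>a'\<in>insert 0 {1, 3}. [x = a + a'] (mod int 4)) \<or>
        (\<exists>b\<in>{0..<4}. \<exists>b'\<in>{0..<4}. [x = b - b'] (mod int 4))"
      by (intro disjI2 bexI[of _ x] bexI[of _ 0]) auto
    show "\<exists>a\<in>insert 0 {1, 3}. \<exists>b\<in>{0..<4}. [x = a + b] (mod int 4)"
      using x by (intro bexI[of _ 0] bexI[of _ x]) auto
  qed auto
  then show ?thesis by simp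
qed

theorem lemma1:
  fixes p d :: nat
  assumes "prime p"
    and "int d = 2 * (int p + \<lceil>sqrt (real p)\<rceil> - 1)"
  shows "DC d 2 \<ge> 2 * p * (p - 1)"
proof -
  define r where "r = nat \<lceil>sqrt (real p)\<rceil>"
  have p2: "p \<ge> 2" using assms(1) prime_ge_2_nat by blast
  have ceil: "\<lceil>sqrt (real p)\<rceil> = int r"
    by (simp add: r_def ceiling_le_iff order_less_le_trans[of "-1" 0])
  have d: "d = 2 * (p + r - 1)" using assms(2) p2 unfolding ceil by presburger
  have sqrt_le: "\<lceil>sqrt (real p)\<rceil> \<le> int k" if "p \<le> k\<^sup>2" for k
  proof -
    have "sqrt (real p) \<le> real k"
      using that by (intro real_le_lsqrt) (auto simp flip: of_nat_power)
    then show ?thesis by (simp add: ceiling_le_iff)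
  qed
  have "p \<le> p\<^sup>2" by (simp add: power2_eq_square)
  then have r_le: "r \<le> p" using sqrt_le ceil by (metis of_nat_le_iff)
  have "sqrt (real p) \<le> real r" unfolding r_def by (rule real_nat_ceiling_ge)
  then have "real p \<le> (real r)\<^sup>2" by (rule sqrt_le_D)
  then have r_ge: "p \<le> r\<^sup>2" by (simp flip: of_nat_power)
  \<comment> \<open>The estimate \<open>2 r + p - 1 \<le> p (p - 1)\<close> follows from \<open>r \<le> p\<close> only for \<open>p \<ge> 4\<close>;
    for \<open>p = 3\<close> it needs the true value \<open>r = 2\<close>.\<close>
  consider "p = 2" | "p = 3" | "p \<ge> 4" using p2 by linarith
  then have "\<exists>n \<in> DC_orders d 2. 2 * p * (p - 1) \<le> n"
  proof cases
    case 1
    have "r \<noteq> 0" "r \<noteq> 1" using r_ge 1 by (metis not_numeral_le_zero zero_power2, force)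
    then have "r = 2" using r_le 1 by linarith
    then show ?thesis using 1 d DC_orders_6 by (intro bexI[of _ 8]) auto
  next
    case 2
    have "r \<le> 2" using sqrt_le[of 2] 2 unfolding ceil by simp
    then have "2 * r + p - 1 \<le> p * (p - 1)" using 2 by simp
    then have "2 * (p * (p - 1)) \<in> DC_orders d 2"
      using 2 r_ge r_le d assms(1) by (intro DC_orders_prime[where r = r]) auto
    then show ?thesis by (metis mult.assoc order_refl)
  next
    case 3
    have "4 * p \<le> p * p" using 3 by simp
    moreover have "p * (p - 1) = p * p - p" by (simp add: diff_mult_distrib2)
    ultimately have "2 * r + p - 1 \<le> p * (p - 1)" using r_le by linarith
    then have "2 * (p * (p - 1)) \<in> DC_orders d 2"
      using 3 r_ge r_le d assms(1) by (intro DC_orders_prime[where r = r]) auto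
    then show ?thesis by (metis mult.assoc order_refl)
  qed
  then show ?thesis
    unfolding DC_def using Max_ge[OF finite_DC_orders] order_trans by blast
qed

end
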